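(* For every $n\ge 1$, $$\sum_{\sigma\in\mathcal{S}_n(132)}a^{\operatorname{des}(\sigma)}q^{\operatorname{maj}(\sigma)}t^{\operatorname{imaj}(\sigma)}=\sum_{\sigma\in\mathcal{S}_n(213)}a^{n-1-\operatorname{des}(\sigma)}q^{\binom{n}{2}-\operatorname{maj}(\sigma)}t^{\binom{n}{2}-\operatorname{imaj}(\sigma)}$$ as polynomials in the indeterminates $a,q,t$.
   Context: $\mathcal{S}_n$ is the symmetric group on $\{1,\dots,n\}$. $\mathcal{S}_n(132)$ is the set of $\sigma\in\mathcal{S}_n$ with no $i<j<k$ satisfying $\sigma_i<\sigma_k<\sigma_j$; $\mathcal{S}_n(213)$ is the set of $\sigma\in\mathcal{S}_n$ with no $i<j<k$ satisfying $\sigma_j<\sigma_i<\sigma_k$. The descent set is $\operatorname{Des}(\sigma)=\{i : 1\le i<n,\ \sigma_i>\sigma_{i+1}\}$, $\operatorname{des}(\sigma)=|\operatorname{Des}(\sigma)|$, $\operatorname{maj}(\sigma)=\sum_{i\in\operatorname{Des}(\sigma)}i$, and $\operatorname{imaj}(\sigma)=\operatorname{maj}(\sigma^{-1})$. *)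

theory Defs
  imports "HOL-Combinatorics.Permutations" "HOL-Computational_Algebra.Polynomial"
begin

text \<open>A permutation in the symmetric group on \<open>{1..n}\<close> is a function \<open>\<sigma> :: nat \<Rightarrow> nat\<close> with
  \<open>\<sigma> permutes {1..n}\<close> (so it is the identity outside \<open>{1..n}\<close>), and its group inverse is \<open>inv \<sigma>\<close>.\<close>

definition S132 :: "nat \<Rightarrow> (nat \<Rightarrow> nat) set" where
  "S132 n = {\<sigma>. \<sigma> permutes {1..n} \<and>
     \<not> (\<exists>i j k. 1 \<le> i \<and> i < j \<and> j < k \<and> k \<le> n \<and> \<sigma> i < \<sigma> k \<and> \<sigma> k < \<sigma> j)}"

definition S213 :: "nat \<Rightarrow> (nat \<Rightarrow> nat) set" where
  "S213 n = {\<sigma>. \<sigma> permutes {1..n} \<and>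
     \<not> (\<exists>i j k. 1 \<le> i \<and> i < j \<and> j < k \<and> k \<le> n \<and> \<sigma> j < \<sigma> i \<and> \<sigma> i < \<sigma> k)}"

definition Des :: "nat \<Rightarrow> (nat \<Rightarrow> nat) \<Rightarrow> nat set" where
  "Des n \<sigma> = {i. 1 \<le> i \<and> i < n \<and> \<sigma> i > \<sigma> (i + 1)}"

definition des :: "nat \<Rightarrow> (nat \<Rightarrow> nat) \<Rightarrow> nat" where
  "des n \<sigma> = card (Des n \<sigma>)"

definition maj :: "nat \<Rightarrow> (nat \<Rightarrow> nat) \<Rightarrow> nat" where
  "maj n \<sigma> = (\<Sum>i\<in>Des n \<sigma>. i)"

definition imaj :: "nat \<Rightarrow> (nat \<Rightarrow> nat) \<Rightarrow> nat" where
  "imaj n \<sigma> = maj n (inv \<sigma>)"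

text \<open>Polynomials in three indeterminates with integer coefficients, as the iterated polynomial
  ring \<open>\<int>[t][q][a]\<close>.\<close>

type_synonym poly_aqt = "int poly poly poly"

definition indet_a :: poly_aqt where "indet_a = [:0, 1:]"
definition indet_q :: poly_aqt where "indet_q = [:[:0, 1:]:]"
definition indet_t :: poly_aqt where "indet_t = [:[:[:0, 1:]:]:]"

text \<open>The following bounds guarantee that the natural-number subtractions \<open>n - 1 - des n \<sigma>\<close>,
  \<open>(n choose 2) - maj n \<sigma>\<close> and \<open>(n choose 2) - imaj n \<sigma>\<close> never truncate.\<close>

lemma des_le: "des n \<sigma> \<le> n - 1"
proof -
  have "card (Des n \<sigma>) \<le> card {1..<n}"
    by (rule card_mono) (auto simp: Des_def)
  then show ?thesis by (simp add: des_def)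
qed

lemma maj_le: "maj n \<sigma> \<le> n choose 2"
proof -
  have "maj n \<sigma> \<le> (\<Sum>i\<in>{0..<n}. i)"
    unfolding maj_def by (rule sum_mono2) (auto simp: Des_def)
  also have "\<dots> = n choose 2"
    by (induction n) (auto simp: numeral_2_eq_2)
  finally show ?thesis .
qed

lemma imaj_le: "imaj n \<sigma> \<le> n choose 2"
  unfolding imaj_def by (rule maj_le)

end

theory Submission
  imports Defs
begin

text \<open>
  A permutation avoiding 132 is determined by its descent set \<open>D\<close> together with the descent set
  \<open>E\<close> of its inverse, and the pairs \<open>(D, E)\<close> that occur are exactly those with \<open>D, E \<subseteq> {1..<n}\<close>,
  \<open>|D| = |E|\<close>, and for each \<open>x < n\<close> at least as many elements of \<open>D\<close> in \<open>{1..x}\<close> as elements of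
  \<open>E\<close> in \<open>{n-x..<n}\<close>. In other words, \<open>D\<close> dominates the reflection of \<open>E\<close>; this is the set
  \<open>DesPairs n\<close>, and the statement is \<open>bij_betw_des_pair_S132\<close>.

  The bijection is built by induction on \<open>n\<close>, prepending a first entry \<open>m + 1\<close> to a
  132-avoiding \<open>\<tau>\<close>. The result avoids 132 exactly if the values of \<open>\<tau>\<close> exceeding \<open>m\<close> appear in
  increasing order, that is, if no inverse descent of \<open>\<tau>\<close> exceeds \<open>m\<close> (\<open>prepend_S132_iff\<close>). The
  new inverse descent set is then the old one together with \<open>m\<close> (if \<open>m > 0\<close>), so that \<open>m\<close> is
  recovered as its maximum, or 0 if it is empty. Applied to \<open>\<tau>\<close> itself, this determines the first
  entry of \<open>\<tau>\<close>, and hence whether 1 becomes a descent. So the effect on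
  \<open>(D, E)\<close> depends on \<open>m\<close> and \<open>(D, E)\<close> alone (\<open>des_pair_prepend\<close>), it is injective
  (\<open>prepend_pair_cancel\<close>), and it respects the dominance condition in both directions
  (\<open>prepend_pair_DesPairs_iff\<close>).

  Reverse-complementation maps the 132-avoiding permutations onto the 213-avoiding ones, commutes
  with inversion, and reflects descent sets by \<open>i \<mapsto> n - i\<close>. Passing from \<open>des, maj, imaj\<close> to
  \<open>n - 1 - des\<close> and so on amounts to complementing both descent sets in \<open>{1..<n}\<close>. Together, the
  right-hand side is the sum of \<open>a^|D| q^(sum of D) t^(sum of E)\<close> over the images of the pairs in
  \<open>DesPairs n\<close> under reflection followed by complement in both components. Reflection and
  complementation each reverse the inequalities of the dominance condition, so the composite is
  an involution of \<open>DesPairs n\<close> (\<open>bij_betw_reflect_compl\<close>), and the two sums agree.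
\<close>

section \<open>Permutations of an initial segment and the pattern 132\<close>

lemma permutes_0: "\<tau> permutes {1..n::nat} \<Longrightarrow> \<tau> 0 = 0"
  by (rule permutes_not_in) auto

lemma permutes_ge1: "\<tau> permutes {1..n::nat} \<Longrightarrow> i \<ge> 1 \<Longrightarrow> \<tau> i \<ge> 1"
  by (metis One_nat_def Suc_leI bot_nat_0.not_eq_extremum not_one_le_zero permutes_0 permutes_inj injD)

lemma permutes_le: "\<tau> permutes {1..n::nat} \<Longrightarrow> i \<le> n \<Longrightarrow> \<tau> i \<le> n"
  by (metis atLeastAtMost_iff le0 less_one linorder_not_le permutes_0 permutes_in_image)

lemma S132_I:
  assumes "\<sigma> permutes {1..n}"
    "\<And>i j k. 1 \<le> i \<Longrightarrow> i < j \<Longrightarrow> j < k \<Longrightarrow> k \<le> n \<Longrightarrow> \<sigma> i < \<sigma> k \<Longrightarrow> \<sigma> k < \<sigma> j \<Longrightarrow> False"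
  shows "\<sigma> \<in> S132 n"
  using assms unfolding S132_def by blast

lemma S132_permutes: "\<sigma> \<in> S132 n \<Longrightarrow> \<sigma> permutes {1..n}"
  by (simp add: S132_def)

lemma S132_D:
  assumes "\<sigma> \<in> S132 n" "1 \<le> i" "i < j" "j < k" "k \<le> n" "\<sigma> i < \<sigma> k"
  shows "\<sigma> j \<le> \<sigma> k"
proof (rule ccontr)
  assume "\<not> \<sigma> j \<le> \<sigma> k"
  then have "\<sigma> k < \<sigma> j" by simp
  then show False using assms unfolding S132_def by blast
qed

section \<open>Reverse-complementation\<close>

text \<open>The order-reversing permutation of \<open>{1..n}\<close>, extended by the identity.\<close>
definition rev_nat :: "nat \<Rightarrow> nat \<Rightarrow> nat" where
  "rev_nat n i = (if 1 \<le> i \<and> i \<le> n then Suc n - i else i)"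

text \<open>The reverse-complement \<open>i \<mapsto> n + 1 - \<sigma>(n + 1 - i)\<close>.\<close>
definition rev_compl :: "nat \<Rightarrow> (nat \<Rightarrow> nat) \<Rightarrow> nat \<Rightarrow> nat" where
  "rev_compl n \<sigma> = rev_nat n \<circ> \<sigma> \<circ> rev_nat n"

lemma rev_nat_rev_nat [simp]: "rev_nat n (rev_nat n i) = i"
  by (auto simp: rev_nat_def)

lemma rev_nat_permutes: "rev_nat n permutes {1..n}"
  by (rule inj_imp_permutes) (auto simp: rev_nat_def inj_on_def)

lemma rev_nat_less: "1 \<le> i \<Longrightarrow> i < j \<Longrightarrow> j \<le> n \<Longrightarrow> rev_nat n j < rev_nat n i"
  by (auto simp: rev_nat_def)

lemma rev_nat_less_iff:
  "1 \<le> i \<Longrightarrow> i \<le> n \<Longrightarrow> 1 \<le> j \<Longrightarrow> j \<le> n \<Longrightarrow> rev_nat n j < rev_nat n i \<longleftrightarrow> i < j"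
  by (auto simp: rev_nat_def)

lemma rev_nat_range: "1 \<le> i \<Longrightarrow> i \<le> n \<Longrightarrow> 1 \<le> rev_nat n i \<and> rev_nat n i \<le> n"
  by (auto simp: rev_nat_def)

lemma rev_compl_rev_compl [simp]: "rev_compl n (rev_compl n \<sigma>) = \<sigma>"
  by (auto simp: rev_compl_def)

lemma rev_compl_permutes: "\<sigma> permutes {1..n} \<Longrightarrow> rev_compl n \<sigma> permutes {1..n}"
  unfolding rev_compl_def by (intro permutes_compose rev_nat_permutes)

lemma inv_rev_compl:
  assumes "\<sigma> permutes {1..n}"
  shows "inv (rev_compl n \<sigma>) = rev_compl n (inv \<sigma>)"
proof
  fix i show "inv (rev_compl n \<sigma>) i = rev_compl n (inv \<sigma>) i"
    unfolding permutes_inv_eq[OF rev_compl_permutes[OF assms]]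
    by (simp add: rev_compl_def permutes_inverses[OF assms])
qed

lemma rev_compl_less_iff:
  assumes "\<sigma> permutes {1..n}" "1 \<le> i" "i \<le> n" "1 \<le> j" "j \<le> n"
  shows "rev_compl n \<sigma> j < rev_compl n \<sigma> i \<longleftrightarrow> \<sigma> (rev_nat n i) < \<sigma> (rev_nat n j)"
  unfolding rev_compl_def comp_def
  using assms rev_nat_range permutes_ge1[OF assms(1)] permutes_le[OF assms(1)]
  by (intro rev_nat_less_iff) auto

lemma rev_compl_S132:
  assumes "\<sigma> \<in> S132 n"
  shows "rev_compl n \<sigma> \<in> S213 n"
proof -
  note p = S132_permutes[OF assms]
  have False if *: "1 \<le> i" "i < j" "j < k" "k \<le> n" "rev_compl n \<sigma> j < rev_compl n \<sigma> i"
    "rev_compl n \<sigma> i < rev_compl n \<sigma> k" for i j k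
  proof -
    have "\<sigma> (rev_nat n i) < \<sigma> (rev_nat n j)" "\<sigma> (rev_nat n k) < \<sigma> (rev_nat n i)"
      using * by (simp_all add: rev_compl_less_iff[OF p])
    then show False
      using S132_D[OF assms, of "rev_nat n k" "rev_nat n j" "rev_nat n i"] *
        rev_nat_less[of i j n] rev_nat_less[of j k n] rev_nat_range[of k n] rev_nat_range[of i n]
      by auto
  qed
  then show ?thesis using rev_compl_permutes[OF p] unfolding S213_def by blast
qed

lemma rev_compl_S213:
  assumes "\<sigma> \<in> S213 n"
  shows "rev_compl n \<sigma> \<in> S132 n"
proof -
  have p: "\<sigma> permutes {1..n}" using assms by (simp add: S213_def)
  show ?thesis
  proof (rule S132_I[OF rev_compl_permutes[OF p]])
    fix i j k assume *: "1 \<le> i" "i < j" "j < k" "k \<le> n"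
      "rev_compl n \<sigma> i < rev_compl n \<sigma> k" "rev_compl n \<sigma> k < rev_compl n \<sigma> j"
    have "\<sigma> (rev_nat n k) < \<sigma> (rev_nat n i)" "\<sigma> (rev_nat n j) < \<sigma> (rev_nat n k)"
      using * by (simp_all add: rev_compl_less_iff[OF p])
    moreover have "1 \<le> rev_nat n k" "rev_nat n k < rev_nat n j" "rev_nat n j < rev_nat n i" "rev_nat n i \<le> n"
      using * rev_nat_less[of i j n] rev_nat_less[of j k n] rev_nat_range[of k n] rev_nat_range[of i n]
      by auto
    ultimately show False using assms unfolding S213_def by blast
  qed
qed

lemma bij_betw_rev_compl: "bij_betw (rev_compl n) (S132 n) (S213 n)"
  by (rule bij_betw_byWitness[where f' = "rev_compl n"]) (auto intro: rev_compl_S132 rev_compl_S213)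

lemma Des_rev_compl:
  assumes "\<sigma> permutes {1..n}"
  shows "Des n (rev_compl n \<sigma>) = {i \<in> {1..<n}. n - i \<in> Des n \<sigma>}"
proof -
  have "i \<in> Des n (rev_compl n \<sigma>) \<longleftrightarrow> n - i \<in> Des n \<sigma>" if "i \<in> {1..<n}" for i
  proof -
    have "i \<in> Des n (rev_compl n \<sigma>) \<longleftrightarrow> rev_compl n \<sigma> (Suc i) < rev_compl n \<sigma> i"
      using that by (auto simp: Des_def)
    also have "\<dots> \<longleftrightarrow> \<sigma> (rev_nat n i) < \<sigma> (rev_nat n (Suc i))"
      using that by (intro rev_compl_less_iff[OF assms]) auto
    also have "\<dots> \<longleftrightarrow> n - i \<in> Des n \<sigma>"
      using that by (auto simp: Des_def rev_nat_def Suc_diff_le)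
    finally show ?thesis .
  qed
  moreover have "Des n (rev_compl n \<sigma>) \<subseteq> {1..<n}" by (auto simp: Des_def)
  ultimately show ?thesis by blast
qed

section \<open>The possible pairs of descent sets, and their reflected complements\<close>

text \<open>Pairs of equally large sets such that \<open>D\<close> dominates the reflection \<open>{n - e | e \<in> E}\<close>. The
  condition \<open>n \<le> e + x\<close> expresses \<open>n - e \<le> x\<close> without subtraction.\<close>
definition DesPairs :: "nat \<Rightarrow> (nat set \<times> nat set) set" where
  "DesPairs n = {(D, E). D \<subseteq> {1..<n} \<and> E \<subseteq> {1..<n} \<and> card D = card E \<and>
     (\<forall>x<n. card {e \<in> E. n \<le> e + x} \<le> card {d \<in> D. d \<le> x})}"

text \<open>The complement in \<open>{1..<n}\<close> of the reflection \<open>{n - d | d \<in> D}\<close>.\<close>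
definition reflect_compl :: "nat \<Rightarrow> nat set \<Rightarrow> nat set" where
  "reflect_compl n D = {i \<in> {1..<n}. n - i \<notin> D}"

lemma card_reflect_below:
  assumes "x < n"
  shows "card {d \<in> reflect_compl n D. d \<le> x} + card {d \<in> D. d < n \<and> n \<le> d + x} = x"
proof -
  have "bij_betw (\<lambda>i. n - i) {d \<in> D. d < n \<and> n \<le> d + x} {i \<in> {1..x}. n - i \<in> D}"
    using assms by (intro bij_betw_byWitness[where f' = "\<lambda>i. n - i"]) auto
  then have "card {d \<in> D. d < n \<and> n \<le> d + x} = card {i \<in> {1..x}. n - i \<in> D}"
    by (rule bij_betw_same_card)
  moreover have "{d \<in> reflect_compl n D. d \<le> x} = {i \<in> {1..x}. n - i \<notin> D}"
    using assms by (auto simp: reflect_compl_def)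
  moreover have "card {1..x} = card ({i \<in> {1..x}. n - i \<notin> D} \<union> {i \<in> {1..x}. n - i \<in> D})"
    by (rule arg_cong[where f = card]) blast
  moreover have "\<dots> = card {i \<in> {1..x}. n - i \<notin> D} + card {i \<in> {1..x}. n - i \<in> D}"
    by (rule card_Un_disjoint) auto
  ultimately show ?thesis by simp
qed

lemma reflect_compl_reflect_compl:
  "D \<subseteq> {1..<n} \<Longrightarrow> reflect_compl n (reflect_compl n D) = D"
  by (auto simp: reflect_compl_def)

lemma card_split_at:
  assumes "D \<subseteq> {1..<n::nat}" "x < n"
  shows "card {d \<in> D. d \<le> x} + card {d \<in> D. n \<le> d + (n - 1 - x)} = card D"
proof -
  have "finite D" using assms finite_subset by blast
  then show ?thesis using assms(2)
    by (subst card_Un_disjoint[symmetric]) (auto intro: arg_cong[where f = card])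
qed

lemma DesPairs_subset: "(D, E) \<in> DesPairs n \<Longrightarrow> D \<subseteq> {1..<n} \<and> E \<subseteq> {1..<n}"
  by (simp add: DesPairs_def)

text \<open>The dominance condition for the new pair at \<open>x\<close> is the old one at \<open>n - 1 - x\<close>.\<close>
lemma reflect_compl_DesPairs:
  assumes "(D, E) \<in> DesPairs n"
  shows "(reflect_compl n D, reflect_compl n E) \<in> DesPairs n"
proof -
  from assms have sub: "D \<subseteq> {1..<n}" "E \<subseteq> {1..<n}" and c: "card D = card E"
    and dom: "\<And>x. x < n \<Longrightarrow> card {e \<in> E. n \<le> e + x} \<le> card {d \<in> D. d \<le> x}"
    by (auto simp: DesPairs_def)
  let ?D = "reflect_compl n D" and ?E = "reflect_compl n E"
  have sub': "?D \<subseteq> {1..<n}" "?E \<subseteq> {1..<n}" by (auto simp: reflect_compl_def)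
  have below: "card {d \<in> reflect_compl n X. d \<le> x} + card {d \<in> X. n \<le> d + x} = x"
    if "X \<subseteq> {1..<n}" "x < n" for X x
  proof -
    have "{d \<in> X. d < n \<and> n \<le> d + x} = {d \<in> X. n \<le> d + x}" using that by auto
    then show ?thesis using card_reflect_below[OF that(2), of X] by simp
  qed
  have all: "card {d \<in> X. d \<le> n - 1} = card X" if "X \<subseteq> {1..<n}" for X
    using that by (intro arg_cong[where f = card]) fastforce
  have all': "card {d \<in> X. n \<le> d + (n - 1)} = card X" if "X \<subseteq> {1..<n}" for X
    using that by (intro arg_cong[where f = card]) fastforce
  have "card ?D = card ?E"
  proof (cases "n = 0")
    case False
    then show ?thesis
      using below[OF sub(1), of "n - 1"] below[OF sub(2), of "n - 1"] c
        all[OF sub'(1)] all[OF sub'(2)] all'[OF sub(1)] all'[OF sub(2)] by linarith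
  qed (simp add: reflect_compl_def)
  moreover have "card {e \<in> ?E. n \<le> e + x} \<le> card {d \<in> ?D. d \<le> x}" if x: "x < n" for x
  proof -
    let ?y = "n - 1 - x"
    have y: "?y < n" "n - 1 - ?y = x" using x by auto
    have "card {e \<in> ?E. n \<le> e + x} + card {e \<in> E. e \<le> x} = x"
      using below[OF sub'(2) x] reflect_compl_reflect_compl[OF sub(2)] by simp
    moreover have "card {d \<in> ?D. d \<le> x} + card {d \<in> D. n \<le> d + x} = x"
      using below[OF sub(1) x] .
    moreover have "card {e \<in> E. e \<le> x} + card {e \<in> E. n \<le> e + ?y} = card E"
      using card_split_at[OF sub(2) x] .
    moreover have "card {d \<in> D. d \<le> ?y} + card {d \<in> D. n \<le> d + x} = card D"
      using card_split_at[OF sub(1) y(1)] y(2) by simp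
    ultimately show ?thesis using dom[OF y(1)] c by linarith
  qed
  ultimately show ?thesis using sub' by (simp add: DesPairs_def)
qed

lemma bij_betw_reflect_compl:
  "bij_betw (map_prod (reflect_compl n) (reflect_compl n)) (DesPairs n) (DesPairs n)"
  by (rule bij_betw_byWitness[where f' = "map_prod (reflect_compl n) (reflect_compl n)"])
    (auto intro: reflect_compl_DesPairs dest: DesPairs_subset simp: reflect_compl_reflect_compl)

lemma reflect_compl_Des:
  assumes "\<sigma> permutes {1..n}"
  shows "reflect_compl n (Des n \<sigma>) = {1..<n} - Des n (rev_compl n \<sigma>)"
  by (auto simp: reflect_compl_def Des_rev_compl[OF assms])

lemma card_compl_Des: "card ({1..<n} - Des n \<sigma>) = n - 1 - des n \<sigma>"
proof -
  have "Des n \<sigma> \<subseteq> {1..<n}" by (auto simp: Des_def)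
  then show ?thesis by (simp add: des_def card_Diff_subset finite_subset)
qed

lemma sum_compl_Des: "\<Sum>({1..<n} - Des n \<sigma>) = (n choose 2) - maj n \<sigma>"
proof -
  have "Des n \<sigma> \<subseteq> {1..<n}" by (auto simp: Des_def)
  then have "\<Sum>({1..<n} - Des n \<sigma>) + maj n \<sigma> = \<Sum>{1..<n}"
    unfolding maj_def by (subst sum.subset_diff) auto
  also have "\<dots> = n choose 2"
    by (induction n) (auto simp: numeral_2_eq_2)
  finally show ?thesis by simp
qed

section \<open>Prepending a first entry to a permutation\<close>

text \<open>The word \<open>(m + 1) \<tau>(1) \<tau>(2) \<dots>\<close>, where the values of \<open>\<tau>\<close> exceeding \<open>m\<close> are raised by one.
  It sends 0 to 0, so that it permutes \<open>{1..n + 1}\<close> if \<open>\<tau>\<close> permutes \<open>{1..n}\<close> and \<open>m \<le> n\<close>.\<close>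
definition prepend :: "nat \<Rightarrow> (nat \<Rightarrow> nat) \<Rightarrow> nat \<Rightarrow> nat" where
  "prepend m \<tau> i = (if i = 0 then 0 else if i = 1 then Suc m
     else if \<tau> (i - 1) \<le> m then \<tau> (i - 1) else Suc (\<tau> (i - 1)))"

lemma prepend_0 [simp]: "prepend m \<tau> 0 = 0"
  and prepend_1 [simp]: "prepend m \<tau> (Suc 0) = Suc m"
  and prepend_Suc: "i \<ge> 1 \<Longrightarrow> prepend m \<tau> (Suc i) = (if \<tau> i \<le> m then \<tau> i else Suc (\<tau> i))"
  by (auto simp: prepend_def)

lemma prepend_less_iff:
  assumes "i \<ge> 1" "j \<ge> 1"
  shows "prepend m \<tau> (Suc i) < prepend m \<tau> (Suc j) \<longleftrightarrow> \<tau> i < \<tau> j"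
  using assms by (simp add: prepend_Suc)

lemma prepend_first_less_iff: "j \<ge> 1 \<Longrightarrow> Suc m < prepend m \<tau> (Suc j) \<longleftrightarrow> m < \<tau> j"
  by (simp add: prepend_Suc)

lemma prepend_permutes:
  assumes "\<tau> permutes {1..n}" "m \<le> n"
  shows "prepend m \<tau> permutes {1..Suc n}"
proof (rule inj_imp_permutes)
  note inj = permutes_inj[OF assms(1), THEN injD]
  show "inj_on (prepend m \<tau>) {1..Suc n}"
  proof (rule inj_onI)
    fix x y assume *: "x \<in> {1..Suc n}" "y \<in> {1..Suc n}" "prepend m \<tau> x = prepend m \<tau> y"
    obtain x' where x: "x = Suc x'" using *(1) by (cases x) simp_all
    obtain y' where y: "y = Suc y'" using *(2) by (cases y) simp_all
    have not_first: "prepend m \<tau> (Suc k) \<noteq> Suc m" if "k \<ge> 1" for k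
      using that by (simp add: prepend_Suc)
    show "x = y"
    proof (cases "x' \<ge> 1 \<and> y' \<ge> 1")
      case True
      then have "\<tau> x' = \<tau> y'"
        using prepend_less_iff[of x' y' m \<tau>] prepend_less_iff[of y' x' m \<tau>] *(3) x y by simp
      then have "x' = y'" by (rule inj)
      then show ?thesis using x y by simp
    next
      case False
      then show ?thesis using *(3) x y not_first[of x'] not_first[of y']
        by (cases "x' = 0"; cases "y' = 0") simp_all
    qed
  qed
  show "prepend m \<tau> x \<in> {1..Suc n}" if "x \<in> {1..Suc n}" for x
    using that permutes_ge1[OF assms(1), of "x - 1"] permutes_le[OF assms(1), of "x - 1"] assms(2)
    by (auto simp: prepend_def)
  show "prepend m \<tau> i = i" if "i \<notin> {1..Suc n}" for i
  proof (cases i)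
    case (Suc k)
    then show ?thesis using that permutes_not_in[OF assms(1), of k] assms(2) by (auto simp: prepend_def)
  qed simp
qed simp

lemma inv_prepend:
  assumes "\<tau> permutes {1..n}" "m \<le> n"
  shows "v \<ge> 1 \<Longrightarrow> v \<le> m \<Longrightarrow> inv (prepend m \<tau>) v = Suc (inv \<tau> v)"
    and "inv (prepend m \<tau>) (Suc m) = 1"
    and "v > m \<Longrightarrow> inv (prepend m \<tau>) (Suc v) = Suc (inv \<tau> v)"
proof -
  note p = prepend_permutes[OF assms]
  note ge = permutes_ge1[OF permutes_inv[OF assms(1)]]
  note iv = permutes_inverses(1)[OF assms(1)]
  show "inv (prepend m \<tau>) v = Suc (inv \<tau> v)" if "v \<ge> 1" "v \<le> m"
    using that ge[of v] iv[of v] by (simp add: permutes_inv_eq[OF p] prepend_Suc)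
  show "inv (prepend m \<tau>) (Suc m) = 1"
    by (simp add: permutes_inv_eq[OF p])
  show "inv (prepend m \<tau>) (Suc v) = Suc (inv \<tau> v)" if "v > m"
    using that ge[of v] iv[of v] by (simp add: permutes_inv_eq[OF p] prepend_Suc)
qed

text \<open>The entry and the remaining permutation are obtained by deleting \<open>\<sigma> 1\<close> and standardizing.\<close>
lemma prepend_exists:
  assumes \<sigma>: "\<sigma> permutes {1..Suc n}"
  obtains m \<tau> where "\<sigma> = prepend m \<tau>" "\<tau> permutes {1..n}" "m \<le> n"
proof
  define \<tau> where "\<tau> i = (if i = 0 then 0 else if \<sigma> (Suc i) < \<sigma> 1 then \<sigma> (Suc i) else \<sigma> (Suc i) - 1)" for i
  note inj = permutes_inj[OF \<sigma>, THEN injD]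
  have ne: "\<sigma> (Suc i) \<noteq> \<sigma> 1" if "i \<ge> 1" for i using inj[of "Suc i" 1] that by auto
  have 1: "1 \<le> \<sigma> 1" "\<sigma> 1 \<le> Suc n"
    using permutes_ge1[OF \<sigma>, of 1] permutes_le[OF \<sigma>, of 1] by auto
  then show "\<sigma> 1 - 1 \<le> n" by simp
  show "\<tau> permutes {1..n}"
  proof (rule inj_imp_permutes)
    show "inj_on \<tau> {1..n}"
    proof (rule inj_onI)
      fix x y assume *: "x \<in> {1..n}" "y \<in> {1..n}" "\<tau> x = \<tau> y"
      then have "\<sigma> (Suc x) = \<sigma> (Suc y)" using ne[of x] ne[of y]
        by (simp add: \<tau>_def split: if_splits)
      then show "x = y" using inj by blast
    qed
    show "\<tau> x \<in> {1..n}" if "x \<in> {1..n}" for x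
      using that ne[of x] permutes_ge1[OF \<sigma>, of "Suc x"] permutes_le[OF \<sigma>, of "Suc x"] 1
      by (auto simp: \<tau>_def)
    show "\<tau> i = i" if "i \<notin> {1..n}" for i
      using that permutes_not_in[OF \<sigma>, of "Suc i"] 1 by (auto simp: \<tau>_def)
  qed simp
  show "\<sigma> = prepend (\<sigma> 1 - 1) \<tau>"
  proof
    fix i show "\<sigma> i = prepend (\<sigma> 1 - 1) \<tau> i"
    proof (cases i)
      case (Suc k)
      then show ?thesis using 1 ne[of k] by (cases "k = 0") (auto simp: prepend_Suc \<tau>_def)
    qed (simp add: permutes_0[OF \<sigma>])
  qed
qed

section \<open>Descents of 132-avoiding permutations\<close>

text \<open>If no inverse descent exceeds \<open>m\<close>, then the values above \<open>m\<close> appear from left to right in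
  increasing order.\<close>
lemma inv_mono_above:
  assumes "Des n (inv \<tau>) \<subseteq> {..m}" "m < v" "v \<le> w" "w \<le> n"
  shows "inv \<tau> v \<le> inv \<tau> w"
  using assms(3,4)
proof (induction w rule: dec_induct)
  case (step w)
  have "w \<notin> Des n (inv \<tau>)" using assms(1,2) step by auto
  then show ?case using step assms(2) by (auto simp: Des_def)
qed simp

lemma Des_inv_E:
  assumes "\<tau> permutes {1..n}" "v \<in> Des n (inv \<tau>)"
  obtains i j where "1 \<le> i" "i < j" "j \<le> n" "\<tau> i = Suc v" "\<tau> j = v" "1 \<le> v" "v < n"
proof (rule that[of "inv \<tau> (Suc v)" "inv \<tau> v"])
  note p = permutes_inv[OF assms(1)]
  from assms(2) show "1 \<le> v" "v < n" "inv \<tau> (Suc v) < inv \<tau> v" by (auto simp: Des_def)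
  then show "1 \<le> inv \<tau> (Suc v)" "inv \<tau> v \<le> n"
    using permutes_ge1[OF p, of "Suc v"] permutes_le[OF p, of v] by auto
qed (use permutes_inverses[OF assms(1)] in auto)

text \<open>The first entry is one more than the largest inverse descent, or 1 if there is none.\<close>
lemma S132_first_entry:
  assumes "\<tau> \<in> S132 n" "n \<ge> 1"
  shows "Des n (inv \<tau>) \<subseteq> {..<\<tau> 1}" "\<tau> 1 - 1 \<in> insert 0 (Des n (inv \<tau>))"
proof -
  note p = S132_permutes[OF assms(1)]
  show "Des n (inv \<tau>) \<subseteq> {..<\<tau> 1}"
  proof
    fix v assume "v \<in> Des n (inv \<tau>)"
    then obtain i j where *: "1 \<le> i" "i < j" "j \<le> n" "\<tau> i = Suc v" "\<tau> j = v"
      using Des_inv_E[OF p] by metis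
    have "\<tau> 1 \<noteq> v" using permutes_inj[OF p, THEN injD, of 1 j] * by auto
    moreover have "\<not> \<tau> 1 < v" using S132_D[OF assms(1), of 1 i j] * by (cases "i = 1") auto
    ultimately show "v \<in> {..<\<tau> 1}" by simp
  qed
  show "\<tau> 1 - 1 \<in> insert 0 (Des n (inv \<tau>))"
  proof (cases "\<tau> 1 = 1")
    case False
    then have *: "\<tau> 1 > 1" "\<tau> 1 \<le> n" using permutes_ge1[OF p, of 1] permutes_le[OF p, of 1] assms(2) by auto
    have "inv \<tau> (\<tau> 1) = 1" using permutes_inverses[OF p] by simp
    moreover have "inv \<tau> (\<tau> 1 - 1) \<noteq> 1" using permutes_inverses(1)[OF p, of "\<tau> 1 - 1"] * by auto
    moreover have "inv \<tau> (\<tau> 1 - 1) \<ge> 1" using permutes_ge1[OF permutes_inv[OF p]] * by auto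
    ultimately show ?thesis using * by (auto simp: Des_def)
  qed simp
qed

text \<open>A 132-pattern using the new first entry amounts to two values above \<open>m\<close> that appear in
  decreasing order, hence to an inverse descent above \<open>m\<close>.\<close>
lemma prepend_S132_iff:
  assumes p: "\<tau> permutes {1..n}" and m: "m \<le> n"
  shows "prepend m \<tau> \<in> S132 (Suc n) \<longleftrightarrow> \<tau> \<in> S132 n \<and> Des n (inv \<tau>) \<subseteq> {..m}"
proof (intro iffI conjI)
  assume *: "prepend m \<tau> \<in> S132 (Suc n)"
  show "\<tau> \<in> S132 n"
  proof (rule S132_I[OF p])
    fix i j k assume a: "1 \<le> i" "i < j" "j < k" "k \<le> n" "\<tau> i < \<tau> k" "\<tau> k < \<tau> j"
    then have "prepend m \<tau> (Suc i) < prepend m \<tau> (Suc k)" "prepend m \<tau> (Suc k) < prepend m \<tau> (Suc j)"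
      by (simp_all add: prepend_less_iff)
    then show False using S132_D[OF *, of "Suc i" "Suc j" "Suc k"] a by simp
  qed
  show "Des n (inv \<tau>) \<subseteq> {..m}"
  proof
    fix v assume "v \<in> Des n (inv \<tau>)"
    then obtain i j where ij: "1 \<le> i" "i < j" "j \<le> n" "\<tau> i = Suc v" "\<tau> j = v"
      using Des_inv_E[OF p] by metis
    have False if "v > m"
    proof -
      have "prepend m \<tau> 1 < prepend m \<tau> (Suc j)" "prepend m \<tau> (Suc j) < prepend m \<tau> (Suc i)"
        using that ij by (simp_all add: prepend_less_iff prepend_first_less_iff)
      then show False using S132_D[OF *, of 1 "Suc i" "Suc j"] ij by auto
    qed
    then show "v \<in> {..m}" by force
  qed
next
  assume *: "\<tau> \<in> S132 n \<and> Des n (inv \<tau>) \<subseteq> {..m}"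
  show "prepend m \<tau> \<in> S132 (Suc n)"
  proof (rule S132_I[OF prepend_permutes[OF p m]])
    fix i j k assume a: "1 \<le> i" "i < j" "j < k" "k \<le> Suc n" "prepend m \<tau> i < prepend m \<tau> k" "prepend m \<tau> k < prepend m \<tau> j"
    define j' k' where "j' = j - 1" and "k' = k - 1"
    then have jk: "j = Suc j'" "k = Suc k'" "1 \<le> j'" "j' < k'" "k' \<le> n" using a(1-4) by simp_all
    have kj: "\<tau> k' < \<tau> j'" using a(6) jk by (simp add: prepend_less_iff)
    show False
    proof (cases "i = 1")
      case True
      then have "m < \<tau> k'" using a(5) jk True by (simp add: prepend_first_less_iff)
      then have "inv \<tau> (\<tau> k') \<le> inv \<tau> (\<tau> j')"
        using * kj jk permutes_le[OF p, of j'] by (intro inv_mono_above[of n \<tau> m]) simp_all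
      then show False using jk by (simp add: permutes_inverses[OF p])
    next
      case False
      define i' where "i' = i - 1"
      then have i: "i = Suc i'" "1 \<le> i'" "i' < j'" using a(1,2) jk False by simp_all
      then have "\<tau> i' < \<tau> k'" using a(5) jk by (simp add: prepend_less_iff)
      then have "\<tau> j' \<le> \<tau> k'" using S132_D[of \<tau> n i' j' k'] * i jk by simp
      then show False using kj by simp
    qed
  qed
qed

lemma Des_inv_prepend:
  assumes p: "\<tau> permutes {1..n}" and m: "m \<le> n" and E: "Des n (inv \<tau>) \<subseteq> {..m}"
  shows "Des (Suc n) (inv (prepend m \<tau>)) = Des n (inv \<tau>) \<union> ({m} - {0})"
proof (rule set_eqI)
  fix v
  note i = inv_prepend[OF p m]
  have ge: "inv \<tau> m \<ge> 1" if "m \<ge> 1" using permutes_ge1[OF permutes_inv[OF p]] that .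
  consider "v = 0" | "1 \<le> v" "v < m" | "v = m" "m \<ge> 1" | "v = Suc m" | w where "v = Suc w" "w > m"
    by (metis One_nat_def Suc_leI Suc_lessE lessI linorder_neqE_nat not_less_eq zero_less_iff_neq_zero less_Suc_eq_0_disj)
  then show "v \<in> Des (Suc n) (inv (prepend m \<tau>)) \<longleftrightarrow> v \<in> Des n (inv \<tau>) \<union> ({m} - {0})"
  proof cases
    case 1 then show ?thesis by (auto simp: Des_def)
  next
    case 2 then show ?thesis using i(1)[of v] i(1)[of "Suc v"] m by (auto simp: Des_def)
  next
    case 3 then show ?thesis using i(1)[of v] i(2) m ge by (auto simp: Des_def)
  next
    case 4
    have "inv (prepend m \<tau>) (Suc v) \<ge> 1"
      using permutes_ge1[OF permutes_inv[OF prepend_permutes[OF p m]]] by simp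
    moreover have "v \<notin> Des n (inv \<tau>)" using E 4 by auto
    ultimately show ?thesis using 4 i(2) by (auto simp: Des_def)
  next
    case 5
    have "w \<notin> Des n (inv \<tau>)" "v \<notin> Des n (inv \<tau>)" using E 5 by auto
    then show ?thesis using 5 i(3)[of w] i(3)[of "Suc w"] by (auto simp: Des_def)
  qed
qed

text \<open>The last term records whether \<open>\<tau> 1 \<le> m\<close>; the inverse descents decide this by the
  characterization of the first entry of \<open>\<tau>\<close>.\<close>
lemma Des_prepend:
  assumes \<tau>: "\<tau> \<in> S132 n" and m: "m \<le> n" and E: "Des n (inv \<tau>) \<subseteq> {..m}"
  shows "Des (Suc n) (prepend m \<tau>) =
    Suc ` Des n \<tau> \<union> (if m \<in> insert 0 (Des n (inv \<tau>)) then {} else {1})"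
proof (rule set_eqI)
  fix i
  have first: "1 \<le> n \<and> \<tau> 1 \<le> m \<longleftrightarrow> m \<notin> insert 0 (Des n (inv \<tau>))"
  proof (cases "n \<ge> 1")
    case True
    show ?thesis
    proof (cases "\<tau> 1 \<le> m")
      case True
      then show ?thesis
        using S132_first_entry(1)[OF \<tau> \<open>n \<ge> 1\<close>] permutes_ge1[OF S132_permutes[OF \<tau>], of 1] \<open>n \<ge> 1\<close>
        by auto
    next
      case False
      then show ?thesis using S132_first_entry(2)[OF \<tau> \<open>n \<ge> 1\<close>] E by (cases "\<tau> 1 - 1 = m") auto
    qed
  qed (use m in auto)
  consider "i = 0" | "i = 1" | k where "i = Suc k" "k \<ge> 1" by (cases i) force+
  then show "i \<in> Des (Suc n) (prepend m \<tau>) \<longleftrightarrow>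
      i \<in> Suc ` Des n \<tau> \<union> (if m \<in> insert 0 (Des n (inv \<tau>)) then {} else {1})"
  proof cases
    case 1 then show ?thesis by (auto simp: Des_def)
  next
    case 2
    have "1 \<in> Des (Suc n) (prepend m \<tau>) \<longleftrightarrow> 1 \<le> n \<and> \<tau> 1 \<le> m"
      by (auto simp: Des_def prepend_Suc[of 1, simplified])
    moreover have "1 \<notin> Suc ` Des n \<tau>" by (auto simp: Des_def)
    ultimately show ?thesis using first 2 by auto
  next
    case 3
    then have "i \<in> Des (Suc n) (prepend m \<tau>) \<longleftrightarrow> k \<in> Des n \<tau>"
      by (simp add: Des_def prepend_less_iff)
    moreover have "i \<in> Suc ` Des n \<tau> \<longleftrightarrow> k \<in> Des n \<tau>" "i \<noteq> 1" using 3 by auto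
    ultimately show ?thesis by simp
  qed
qed

section \<open>Prepending and pairs of descent sets\<close>

text \<open>The effect of prepending the entry \<open>m + 1\<close> on the descent set and the inverse descent set.\<close>
definition prepend_pair :: "nat \<Rightarrow> nat set \<times> nat set \<Rightarrow> nat set \<times> nat set" where
  "prepend_pair m = (\<lambda>(D, E). (Suc ` D \<union> (if m \<in> insert 0 E then {} else {1}), E \<union> ({m} - {0})))"

lemma card_Suc_image_le: "card {d \<in> Suc ` D. d \<le> Suc x} = card {d \<in> D. d \<le> x}"
proof -
  have "{d \<in> Suc ` D. d \<le> Suc x} = Suc ` {d \<in> D. d \<le> x}" by auto
  then show ?thesis by (simp add: card_image)
qed

text \<open>The dominance condition at \<open>x + 1\<close> for the new pair is the one at \<open>x\<close> for the old pair: if 1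
  and \<open>m\<close> are added, then the count for the first component grows by one, and so does the count for
  the second unless \<open>x\<close> is so small that no element of \<open>insert m E\<close> is counted at all.\<close>
lemma prepend_pair_DesPairs_iff:
  assumes D: "D \<subseteq> {1..}" and E: "E \<subseteq> {1..m}" and m: "m \<le> n"
  shows "prepend_pair m (D, E) \<in> DesPairs (Suc n) \<longleftrightarrow> (D, E) \<in> DesPairs n"
proof -
  have fE: "finite E" using E finite_subset by blast
  have all: "(\<forall>x<Suc n. Q x) \<longleftrightarrow> Q 0 \<and> (\<forall>x<n. Q (Suc x))" for Q
    by (auto simp: less_Suc_eq_0_disj)
  have sub: "Suc ` D \<subseteq> {1..<Suc n} \<longleftrightarrow> D \<subseteq> {1..<n}"
    using D by (auto simp: image_subset_iff subset_iff)
  show ?thesis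
  proof (cases "m \<in> insert 0 E")
    case True
    then have eq: "prepend_pair m (D, E) = (Suc ` D, E)" by (auto simp: prepend_pair_def)
    have E1: "E \<subseteq> {1..<Suc n}" using E m by auto
    then have 0: "{e \<in> E. Suc n \<le> e + 0} = {}" by auto
    \<comment> \<open>The new condition at \<open>x = 1\<close> is the old one at \<open>x = 0\<close>; it excludes \<open>n\<close> from \<open>E\<close>.\<close>
    have E2: "E \<subseteq> {1..<n}" if "\<forall>x<n. card {e \<in> E. n \<le> e + x} \<le> card {d \<in> D. d \<le> x}"
    proof (cases "n = 0")
      case False
      have "{d \<in> D. d \<le> 0} = {}" using D by auto
      then have "card {d \<in> D. d \<le> 0} = 0" by (simp only: card.empty)
      then have "card {e \<in> E. n \<le> e + 0} = 0" using that[rule_format, of 0] False by linarith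
      then have "{e \<in> E. n \<le> e} = {}" using fE by simp
      then show ?thesis using E by fastforce
    qed (use E m in auto)
    have dom: "(\<forall>x<Suc n. card {e \<in> E. Suc n \<le> e + x} \<le> card {d \<in> Suc ` D. d \<le> x})
        \<longleftrightarrow> (\<forall>x<n. card {e \<in> E. n \<le> e + x} \<le> card {d \<in> D. d \<le> x})"
      unfolding all 0 by (simp add: card_Suc_image_le)
    have c: "card (Suc ` D) = card D" by (simp add: card_image)
    show ?thesis unfolding eq DesPairs_def mem_Collect_eq case_prod_conv dom sub c
      using E1 E2 by blast
  next
    case False
    then have eq: "prepend_pair m (D, E) = (insert 1 (Suc ` D), insert m E)" and m0: "m \<ge> 1" "m \<notin> E"
      by (auto simp: prepend_pair_def)
    have Em: "E \<subseteq> {1..<m}" using E m0 by (auto simp: less_le)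
    then have E1: "insert m E \<subseteq> {1..<Suc n}" "E \<subseteq> {1..<n}" using m m0 by auto
    then have 0: "{e \<in> insert m E. Suc n \<le> e + 0} = {}" by auto
    have 1: "1 \<notin> Suc ` D" using D by auto
    have sub': "insert 1 (Suc ` D) \<subseteq> {1..<Suc n} \<longleftrightarrow> D \<subseteq> {1..<n}" using sub m m0 by auto
    have fD: "finite D" if "D \<subseteq> {1..<n}" using that finite_subset by blast
    have step: "card {e \<in> insert m E. Suc n \<le> e + Suc x} \<le> card {d \<in> insert 1 (Suc ` D). d \<le> Suc x}
        \<longleftrightarrow> card {e \<in> E. n \<le> e + x} \<le> card {d \<in> D. d \<le> x}" if "D \<subseteq> {1..<n}" for x
    proof -
      have "{d \<in> insert 1 (Suc ` D). d \<le> Suc x} = insert 1 {d \<in> Suc ` D. d \<le> Suc x}" by auto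
      then have r: "card {d \<in> insert 1 (Suc ` D). d \<le> Suc x} = Suc (card {d \<in> D. d \<le> x})"
        using 1 fD[OF that] by (simp add: card_Suc_image_le)
      show ?thesis
      proof (cases "n \<le> m + x")
        case True
        then have "{e \<in> insert m E. Suc n \<le> e + Suc x} = insert m {e \<in> E. n \<le> e + x}" by auto
        then show ?thesis using r m0 fE by simp
      next
        case False
        then have empty: "{e \<in> insert m E. Suc n \<le> e + Suc x} = {}" "{e \<in> E. n \<le> e + x} = {}"
          using Em by auto
        show ?thesis unfolding empty by simp
      qed
    qed
    have c: "card (insert 1 (Suc ` D)) = Suc (card D)" if "D \<subseteq> {1..<n}"
      using 1 fD[OF that] by (simp add: card_image)
    have c': "card (insert m E) = Suc (card E)" using fE m0 by simp
    have dom: "(\<forall>x<Suc n. card {e \<in> insert m E. Suc n \<le> e + x} \<le> card {d \<in> insert 1 (Suc ` D). d \<le> x})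
        \<longleftrightarrow> (\<forall>x<n. card {e \<in> E. n \<le> e + x} \<le> card {d \<in> D. d \<le> x})" if "D \<subseteq> {1..<n}"
      unfolding all 0 by (simp only: step[OF that] card.empty) simp
    show ?thesis
    proof (cases "D \<subseteq> {1..<n}")
      case True
      then show ?thesis unfolding eq DesPairs_def mem_Collect_eq case_prod_conv
          dom[OF True] sub' c[OF True] c' using E1 by blast
    next
      case False
      then show ?thesis unfolding eq DesPairs_def mem_Collect_eq case_prod_conv sub' by blast
    qed
  qed
qed

text \<open>Every admissible pair arises with \<open>m\<close> the maximum of \<open>E'\<close> (0 if \<open>E'\<close> is empty); \<open>m\<close> is removed
  from \<open>E'\<close> precisely if 1 is in \<open>D'\<close>.\<close>
lemma prepend_pair_exists:
  assumes "(D', E') \<in> DesPairs (Suc n)"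
  obtains m D E where "(D', E') = prepend_pair m (D, E)" "D \<subseteq> {1..}" "E \<subseteq> {1..m}" "m \<le> n"
proof
  let ?m = "Max (insert 0 E')"
  let ?D = "{d. d \<ge> 1 \<and> Suc d \<in> D'}"
  let ?E = "if 1 \<in> D' then E' - {?m} else E'"
  from assms have sub: "D' \<subseteq> {1..<Suc n}" "E' \<subseteq> {1..<Suc n}" and c: "card D' = card E'"
    by (auto simp: DesPairs_def)
  then have fin: "finite D'" "finite E'" using finite_subset by blast+
  have in_m: "?m \<in> insert 0 E'" using fin by (intro Max_in) auto
  then show "?m \<le> n" using sub by auto
  have le_m: "\<forall>e\<in>E'. e \<le> ?m" using fin by auto
  then show "?E \<subseteq> {1..?m}" using sub by auto
  have img: "D' - {1} = Suc ` ?D"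
  proof
    show "D' - {1} \<subseteq> Suc ` ?D"
    proof
      fix d assume "d \<in> D' - {1}"
      then show "d \<in> Suc ` ?D" using sub by (cases d) auto
    qed
  qed auto
  show "(D', E') = prepend_pair ?m (?D, ?E)"
  proof (cases "1 \<in> D'")
    case True
    then have "card E' \<noteq> 0" using c fin by auto
    then obtain e where e: "e \<in> E'" by (metis card.empty equals0I)
    then have "1 \<le> e" "e \<le> ?m" using le_m sub by auto
    then have "?m \<noteq> 0" by linarith
    then have "?m \<noteq> 0" "?m \<in> E'" using in_m by auto
    then show ?thesis using True img by (auto simp: prepend_pair_def)
  next
    case False
    then show ?thesis using img in_m by (auto simp: prepend_pair_def)
  qed
qed auto

section \<open>The bijection between 132-avoiding permutations and pairs\<close>

text \<open>The descent set of a permutation together with that of its inverse.\<close>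
definition des_pair :: "nat \<Rightarrow> (nat \<Rightarrow> nat) \<Rightarrow> nat set \<times> nat set" where
  "des_pair n \<sigma> = (Des n \<sigma>, Des n (inv \<sigma>))"

lemma des_pair_prepend:
  assumes "\<tau> \<in> S132 n" "m \<le> n" "Des n (inv \<tau>) \<subseteq> {..m}"
  shows "des_pair (Suc n) (prepend m \<tau>) = prepend_pair m (des_pair n \<tau>)"
  using Des_prepend[OF assms] Des_inv_prepend[OF S132_permutes[OF assms(1)] assms(2,3)]
  by (simp add: des_pair_def prepend_pair_def)

lemma Des_ge1: "Des n \<sigma> \<subseteq> {1..}"
  by (auto simp: Des_def)

lemma prepend_pair_cancel:
  assumes "prepend_pair m (D, E) = prepend_pair m' (D', E')" "D \<subseteq> {1..}" "D' \<subseteq> {1..}" "E \<subseteq> {1..m}" "E' \<subseteq> {1..m'}"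
  shows "m = m' \<and> D = D' \<and> E = E'"
proof -
  have fin: "finite E" "finite E'" using assms(4,5) finite_subset by blast+
  have F: "E \<union> ({m} - {0}) = E' \<union> ({m'} - {0})" and
    G: "Suc ` D \<union> (if m \<in> insert 0 E then {} else {1}) = Suc ` D' \<union> (if m' \<in> insert 0 E' then {} else {1})"
    using assms(1) by (simp_all add: prepend_pair_def)
  have max: "Max (insert 0 (A \<union> ({k} - {0}))) = k" if "A \<subseteq> {1..k}" "finite A" for A and k :: nat
    using that by (intro Max_eqI) auto
  have m: "m = m'" using max[OF assms(4)] max[OF assms(5)] fin F by simp
  have one: "1 \<notin> Suc ` D" "1 \<notin> Suc ` D'" using assms by auto
  then have mE: "m \<in> insert 0 E \<longleftrightarrow> m \<in> insert 0 E'"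
    using G m by (auto split: if_splits)
  have "Suc ` D = Suc ` D'" using one G mE m insert_ident[OF one] by (auto split: if_splits)
  then have "D = D'" by (simp add: inj_image_eq_iff)
  moreover have "E = E'" using F mE m assms(4,5) by (cases "m = 0") auto
  ultimately show ?thesis using m by simp
qed

lemma S132_Suc_cases:
  assumes "\<sigma> \<in> S132 (Suc n)"
  obtains m \<tau> where "\<sigma> = prepend m \<tau>" "\<tau> \<in> S132 n" "m \<le> n" "Des n (inv \<tau>) \<subseteq> {..m}"
  using prepend_exists[OF S132_permutes[OF assms]] prepend_S132_iff assms by metis

lemma des_pair_S132_inj: "inj_on (des_pair n) (S132 n)"
proof (induction n)
  case 0
  then show ?case by (auto simp: S132_def inj_on_def)
next
  case (Suc n)
  show ?case
  proof (rule inj_onI)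
    fix \<sigma> \<sigma>' assume a: "\<sigma> \<in> S132 (Suc n)" "\<sigma>' \<in> S132 (Suc n)" "des_pair (Suc n) \<sigma> = des_pair (Suc n) \<sigma>'"
    from S132_Suc_cases[OF a(1)] obtain m \<tau>
      where 1: "\<sigma> = prepend m \<tau>" "\<tau> \<in> S132 n" "m \<le> n" "Des n (inv \<tau>) \<subseteq> {..m}" .
    from S132_Suc_cases[OF a(2)] obtain m' \<tau>'
      where 2: "\<sigma>' = prepend m' \<tau>'" "\<tau>' \<in> S132 n" "m' \<le> n" "Des n (inv \<tau>') \<subseteq> {..m'}" .
    from a(3) have "prepend_pair m (des_pair n \<tau>) = prepend_pair m' (des_pair n \<tau>')"
      using 1 2 by (simp add: des_pair_prepend)
    moreover have "Des n (inv \<tau>) \<subseteq> {1..m}" "Des n (inv \<tau>') \<subseteq> {1..m'}"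
      using Des_ge1[of n] 1(4) 2(4) by fastforce+
    ultimately have "m = m' \<and> des_pair n \<tau> = des_pair n \<tau>'"
      unfolding des_pair_def using prepend_pair_cancel Des_ge1 by blast
    then show "\<sigma> = \<sigma>'" using Suc 1 2 by (auto dest: inj_onD)
  qed
qed

lemma des_pair_S132_image: "des_pair n ` S132 n = DesPairs n"
proof (induction n)
  case 0
  then show ?case by (auto simp: S132_def DesPairs_def des_pair_def Des_def)
next
  case (Suc n)
  have iff: "prepend_pair m (des_pair n \<tau>) \<in> DesPairs (Suc n) \<longleftrightarrow> des_pair n \<tau> \<in> DesPairs n"
    if "m \<le> n" "Des n (inv \<tau>) \<subseteq> {..m}" for m \<tau>
    unfolding des_pair_def using that Des_ge1[of n]
    by (intro prepend_pair_DesPairs_iff) (auto simp: subset_iff)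
  show ?case
  proof (intro equalityI subsetI)
    fix X assume "X \<in> des_pair (Suc n) ` S132 (Suc n)"
    then obtain \<sigma> where \<sigma>: "\<sigma> \<in> S132 (Suc n)" "X = des_pair (Suc n) \<sigma>" by auto
    from S132_Suc_cases[OF \<sigma>(1)] obtain m \<tau>
      where 1: "\<sigma> = prepend m \<tau>" "\<tau> \<in> S132 n" "m \<le> n" "Des n (inv \<tau>) \<subseteq> {..m}" .
    then show "X \<in> DesPairs (Suc n)" using \<sigma> Suc iff by (auto simp: des_pair_prepend)
  next
    fix X assume X: "X \<in> DesPairs (Suc n)"
    then obtain m D E where 1: "X = prepend_pair m (D, E)" "D \<subseteq> {1..}" "E \<subseteq> {1..m}" "m \<le> n"
      using prepend_pair_exists by (cases X) metis
    then have "(D, E) \<in> des_pair n ` S132 n" using X Suc by (simp add: prepend_pair_DesPairs_iff)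
    then obtain \<tau> where \<tau>: "\<tau> \<in> S132 n" "des_pair n \<tau> = (D, E)" by force
    then have E: "Des n (inv \<tau>) \<subseteq> {..m}" using 1 by (auto simp: des_pair_def)
    then have "prepend m \<tau> \<in> S132 (Suc n)" using \<tau> 1 S132_permutes by (simp add: prepend_S132_iff)
    then show "X \<in> des_pair (Suc n) ` S132 (Suc n)"
      using des_pair_prepend[OF \<tau>(1) 1(4) E] \<tau> 1 by (metis image_eqI)
  qed
qed

lemma bij_betw_des_pair_S132: "bij_betw (des_pair n) (S132 n) (DesPairs n)"
  by (simp add: bij_betw_def des_pair_S132_inj des_pair_S132_image)


section \<open>Equality of the generating functions\<close>

theorem theorem5p8:
  fixes n :: nat
  assumes "n \<ge> 1"
  shows "(\<Sum>\<sigma>\<in>S132 n. indet_a ^ des n \<sigma> * indet_q ^ maj n \<sigma> * indet_t ^ imaj n \<sigma>) =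
         (\<Sum>\<sigma>\<in>S213 n. indet_a ^ (n - 1 - des n \<sigma>) * indet_q ^ ((n choose 2) - maj n \<sigma>) *
                        indet_t ^ ((n choose 2) - imaj n \<sigma>))"
proof -
  define w where "w = (\<lambda>(D, E). indet_a ^ card D * indet_q ^ \<Sum>D * indet_t ^ \<Sum>E)"
  let ?R = "map_prod (reflect_compl n) (reflect_compl n)"
  let ?f = "\<lambda>\<sigma>. indet_a ^ (n - 1 - des n \<sigma>) * indet_q ^ ((n choose 2) - maj n \<sigma>) *
                 indet_t ^ ((n choose 2) - imaj n \<sigma>)"
  have "(\<Sum>\<sigma>\<in>S132 n. indet_a ^ des n \<sigma> * indet_q ^ maj n \<sigma> * indet_t ^ imaj n \<sigma>)
      = (\<Sum>\<sigma>\<in>S132 n. w (des_pair n \<sigma>))"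
    by (simp add: w_def des_pair_def des_def maj_def imaj_def)
  also have "\<dots> = sum w (DesPairs n)"
    by (rule sum.reindex_bij_betw[OF bij_betw_des_pair_S132])
  also have "\<dots> = (\<Sum>X\<in>DesPairs n. w (?R X))"
    by (rule sum.reindex_bij_betw[OF bij_betw_reflect_compl, symmetric])
  also have "\<dots> = (\<Sum>\<sigma>\<in>S132 n. w (?R (des_pair n \<sigma>)))"
    by (rule sum.reindex_bij_betw[OF bij_betw_des_pair_S132, symmetric])
  also have "\<dots> = (\<Sum>\<sigma>\<in>S132 n. ?f (rev_compl n \<sigma>))"
  proof (rule sum.cong[OF refl])
    fix \<sigma> assume "\<sigma> \<in> S132 n"
    then have p: "\<sigma> permutes {1..n}" by (rule S132_permutes)
    show "w (?R (des_pair n \<sigma>)) = ?f (rev_compl n \<sigma>)"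
      by (simp add: w_def des_pair_def reflect_compl_Des[OF p] reflect_compl_Des[OF permutes_inv[OF p]]
          card_compl_Des sum_compl_Des imaj_def inv_rev_compl[OF p] del: One_nat_def)
  qed
  also have "\<dots> = sum ?f (S213 n)"
    by (rule sum.reindex_bij_betw[OF bij_betw_rev_compl])
  finally show ?thesis .
qed

end
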